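(* Let $d\ge 2$. For all $\beta>0$ and $B\in\mathbb{R}$, the limiting annealed pressure $\psi(\beta,B)$ of the Ising model on the random $d$-regular graph equals the quenched pressure $\tilde\psi(\beta,B)$: $$\psi(\beta,B)=\tilde\psi(\beta,B).$$ In particular, when $d=2$, $$\psi(\beta,B)=\beta+\log\left(\cosh(B)+\sqrt{\sinh^2(B)+e^{-4\beta}}\right).$$
   Context: The limiting annealed pressure is $$\psi(\beta,B)=\frac{\beta d}{2}-B+\max_{0\le t\le 1}\Big[(t-1)\log(1-t)-t\log t+2Bt+dF(t)\Big],$$ with $F(t)=\int_0^{\min\{t,1-t\}}\log f(s)\,ds$, $f(s)=\frac{e^{-2\beta}(1-2s)+\sqrt{1+(e^{-4\beta}-1)(1-2s)^2}}{2(1-s)}$, and $0\log 0=0$. (It is the limit of $\frac1n\log\mathbb{E}(Z_n(\beta,B))$, where $Z_n$ is the Ising partition function on the $n$-vertex random $d$-regular graph.) The quenched pressure $\tilde\psi(\beta,B)$ (the limit of $\frac1n\log Z_n(\beta,B)$) is given by the following known formula. For $\beta>0$, $B>0$, let $h_*$ be the positive solution of $h=B+(d-1)\operatorname{atanh}(\tanh(\beta)\tanh(h))$. Then $$\tilde\psi(\beta,B)=\frac d2\log(\cosh\beta)-\frac d2\log\left(1+\tanh(\beta)\tanh(h_* )^2\right)+\log\left[e^B(1+\tanh(\beta)\tanh(h_* ))^d+e^{-B}(1-\tanh(\beta)\tanh(h_* ))^d\right].$$ For $B<0$, $\tilde\psi(\beta,B)=\tilde\psi(\beta,-B)$, and $\tilde\psi(\beta,0)=\lim_{B\downarrow0}\tilde\psi(\beta,B)$.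 *)

theory Defs
  imports "HOL-Analysis.Analysis"
begin

definition ising_f :: "real \<Rightarrow> real \<Rightarrow> real" where
  "ising_f \<beta> s =
     (exp (- 2 * \<beta>) * (1 - 2 * s) + sqrt (1 + (exp (- 4 * \<beta>) - 1) * (1 - 2 * s)\<^sup>2))
       / (2 * (1 - s))"

definition ising_F :: "real \<Rightarrow> real \<Rightarrow> real" where
  "ising_F \<beta> t = integral {0..min t (1 - t)} (\<lambda>s. ln (ising_f \<beta> s))"

text \<open>The convention \<open>0 log 0 = 0\<close> holds automatically below, since \<open>0 * x = 0\<close>.\<close>

definition annealed_objective :: "nat \<Rightarrow> real \<Rightarrow> real \<Rightarrow> real \<Rightarrow> real" where
  "annealed_objective d \<beta> B t =
     (t - 1) * ln (1 - t) - t * ln t + 2 * B * t + real d * ising_F \<beta> t"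

text \<open>\<open>GREATEST\<close> on the image is the maximum itself (an attained value), not just a supremum.\<close>

definition annealed_pressure :: "nat \<Rightarrow> real \<Rightarrow> real \<Rightarrow> real" where
  "annealed_pressure d \<beta> B =
     \<beta> * real d / 2 - B + (GREATEST y. y \<in> annealed_objective d \<beta> B ` {0..1})"

text \<open>The positive fixed point; it exists and is unique for \<open>\<beta> > 0\<close>, \<open>B > 0\<close>, \<open>d \<ge> 2\<close>.\<close>

definition h_star :: "nat \<Rightarrow> real \<Rightarrow> real \<Rightarrow> real" where
  "h_star d \<beta> B =
     (THE h. h > 0 \<and> h = B + (real d - 1) * artanh (tanh \<beta> * tanh h))"

definition quenched_pressure_pos :: "nat \<Rightarrow> real \<Rightarrow> real \<Rightarrow> real" where
  "quenched_pressure_pos d \<beta> B =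
     real d / 2 * ln (cosh \<beta>)
     - real d / 2 * ln (1 + tanh \<beta> * (tanh (h_star d \<beta> B))\<^sup>2)
     + ln (exp B * (1 + tanh \<beta> * tanh (h_star d \<beta> B)) ^ d
           + exp (- B) * (1 - tanh \<beta> * tanh (h_star d \<beta> B)) ^ d)"

definition quenched_pressure :: "nat \<Rightarrow> real \<Rightarrow> real \<Rightarrow> real" where
  "quenched_pressure d \<beta> B =
     (if B > 0 then quenched_pressure_pos d \<beta> B
      else if B < 0 then quenched_pressure_pos d \<beta> (- B)
      else Lim (at_right 0) (quenched_pressure_pos d \<beta>))"

end

theory Submission
  imports Defs "HOL-Real_Asymp.Real_Asymp"
begin

text \<open>
Write \<open>\<theta> = tanh \<beta>\<close> and let \<open>t\<close> be the fraction of plus spins. The annealed and the quenched pressure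
look different because the first is written in terms of \<open>t\<close> and the second in terms of a cavity field
\<open>h\<close>. They become the same once \<open>t\<close> is expressed through \<open>h\<close>: put \<open>m = tanh h\<close> and let
\<open>u = artanh (\<theta> m)\<close> be the message that one neighbour sends along an edge. A vertex with cavity field
\<open>h\<close> that receives one more message has total field \<open>h + u\<close>, hence
\<open>2 t - 1 = tanh (h + u) = m (1 + \<theta>) / (1 + \<theta> m\<^sup>2)\<close>. In this parameter the square root in
\<open>ising_f\<close> is rational and the whole expression collapses to \<open>exp (2 u)\<close>
(\<open>ising_f_at_magnetisation\<close>, stated for the mirror image \<open>1 - t\<close>), so the integral
\<open>ising_F\<close> has a closed form (\<open>ising_F_at_magnetisation\<close>).

The derivative of the annealed objective in \<open>t\<close> is then
\<open>2 (B + (d - 1) u - h)\<close>: its critical points solve exactly the fixed-point equation of \<open>h_star\<close>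
(\<open>annealed_objective_magnetisation_has_derivative\<close>). For \<open>B > 0\<close> the gap \<open>B + (d - 1) u - h\<close> is concave in
\<open>h \<ge> 0\<close> and positive at \<open>0\<close>, so it changes sign once, from plus to minus, at \<open>h_star\<close>
(\<open>h_star_properties\<close>). Thus the maximum over \<open>t \<ge> 1/2\<close> sits there, and the
reflection \<open>t \<mapsto> 1 - t\<close> shows that \<open>t < 1/2\<close> cannot do better when \<open>B > 0\<close>. At the critical point the
two spin weights in the quenched formula are in the proportion \<open>t : 1 - t\<close>, which turns the entropy into
the logarithm of their sum (\<open>annealed_objective_at_fixed_point\<close>).

Both pressures are even in \<open>B\<close>, and the annealed one is Lipschitz in \<open>B\<close>, which settle
\<open>B < 0\<close> and \<open>B = 0\<close>, where the quenched pressure is a limit. For \<open>d = 2\<close> the fixed-point equation expresses \<open>tanh B\<close>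
rationally in \<open>\<theta>\<close> and \<open>m\<close>, and the explicit formula is an algebraic identity in these two numbers.
\<close>

section \<open>Inverse hyperbolic tangent\<close>

lemma twice_artanh_real: "2 * artanh x = ln (1 + x) - ln (1 - x)"
  if "-1 < x" "x < 1" for x :: real
  using that by (simp add: artanh_def ln_div)

lemma artanh_real_mono: "artanh x \<le> artanh y"
  if "-1 < x" "x \<le> y" "y < 1" for x y :: real
proof -
  have "ln (1 + x) \<le> ln (1 + y)" "ln (1 - y) \<le> ln (1 - x)" using that by simp_all
  then show ?thesis using twice_artanh_real[of x] twice_artanh_real[of y] that by linarith
qed

lemma tanh_artanh_real: "tanh (artanh x) = x" if "-1 < x" "x < 1" for x :: real
proof -
  have "exp (- (2 * artanh x)) = exp (ln (1 - x) - ln (1 + x))"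
    using twice_artanh_real[OF that] by simp
  also have "\<dots> = (1 - x) / (1 + x)" using that by (simp add: exp_diff)
  finally have e: "exp (- 2 * artanh x) = (1 - x) / (1 + x)" by simp
  have "1 - (1 - x) / (1 + x) = 2 * x / (1 + x)" "1 + (1 - x) / (1 + x) = 2 / (1 + x)"
    using that by (simp_all add: field_simps)
  then show ?thesis unfolding tanh_real_altdef e using that by simp
qed

section \<open>Parametrisation by the cavity field\<close>

text \<open>With \<open>m = tanh h\<close> this is \<open>tanh (h + artanh (\<theta> * m))\<close>, by the addition theorem. The algebraic form
is used because it also makes sense at \<open>m = 1\<close>, where \<open>h\<close> is infinite and all spins are plus.\<close>

definition magnetisation :: "real \<Rightarrow> real \<Rightarrow> real" where
  "magnetisation \<theta> m = m * (1 + \<theta>) / (1 + \<theta> * m\<^sup>2)"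

lemma denominator_pos: "0 < 1 + \<theta> * m\<^sup>2" if "0 < \<theta>" for \<theta> m :: real
  using that by (simp add: add_pos_nonneg)

lemma cavity_product_less_one:
  fixes \<theta> m :: real
  assumes "0 < \<theta>" "\<theta> < 1" "0 \<le> m" "m \<le> 1"
  shows "0 \<le> \<theta> * m" "\<theta> * m < 1" "\<theta> * m\<^sup>2 < 1"
proof -
  show "0 \<le> \<theta> * m" using assms by simp
  have "\<theta> * m \<le> \<theta> * 1" using assms by (intro mult_left_mono) auto
  then show "\<theta> * m < 1" using assms by linarith
  have "\<theta> * m\<^sup>2 \<le> \<theta> * 1" using assms by (intro mult_left_mono power_le_one) auto
  then show "\<theta> * m\<^sup>2 < 1" using assms by linarith
qed

lemma magnetisation_one [simp]: "magnetisation \<theta> 1 = 1" if "0 < \<theta>"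
  using that by (simp add: magnetisation_def)

lemma magnetisation_zero [simp]: "magnetisation \<theta> 0 = 0"
  by (simp add: magnetisation_def)

lemma one_plus_magnetisation: "1 + magnetisation \<theta> m = (1 + m) * (1 + \<theta> * m) / (1 + \<theta> * m\<^sup>2)" if "0 < \<theta>"
  using denominator_pos[OF that, of m] by (simp add: magnetisation_def field_simps power2_eq_square)

lemma one_minus_magnetisation: "1 - magnetisation \<theta> m = (1 - m) * (1 - \<theta> * m) / (1 + \<theta> * m\<^sup>2)" if "0 < \<theta>"
  using denominator_pos[OF that, of m] by (simp add: magnetisation_def field_simps power2_eq_square)

lemma magnetisation_bounds:
  assumes "0 < \<theta>" "\<theta> < 1" "0 \<le> m" "m \<le> 1"
  shows "0 \<le> magnetisation \<theta> m" "magnetisation \<theta> m \<le> 1"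
proof -
  show "0 \<le> magnetisation \<theta> m" using assms denominator_pos[of \<theta> m] by (simp add: magnetisation_def)
  have "0 \<le> 1 - magnetisation \<theta> m"
    using assms denominator_pos[of \<theta> m] cavity_product_less_one[of \<theta> m]
    by (simp add: one_minus_magnetisation)
  then show "magnetisation \<theta> m \<le> 1" by simp
qed

lemma magnetisation_has_derivative:
  assumes "0 < \<theta>"
  shows "(magnetisation \<theta> has_real_derivative (1 + \<theta>) * (1 - \<theta> * m\<^sup>2) / (1 + \<theta> * m\<^sup>2)\<^sup>2) (at m within S)"
  unfolding magnetisation_def using denominator_pos[OF assms, of m]
  by (auto intro!: derivative_eq_intros simp: field_simps power2_eq_square)

lemma magnetisation_surj:
  assumes "0 < \<theta>" "0 \<le> x" "x \<le> 1"
  shows "\<exists>m. 0 \<le> m \<and> m \<le> 1 \<and> magnetisation \<theta> m = x"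
proof -
  have "continuous_on {0..1} (magnetisation \<theta>)"
    by (rule DERIV_continuous_on) (rule magnetisation_has_derivative[OF assms(1)])
  then show ?thesis using assms by (intro IVT') auto
qed

lemma exp_minus_twice_eq_tanh: "exp (- (2 * \<beta>)) = (1 - tanh \<beta>) / (1 + tanh \<beta>)" for \<beta> :: real
proof -
  define e where "e = exp (- (2 * \<beta>))"
  have "e > 0" by (simp add: e_def)
  have "tanh \<beta> = (1 - e) / (1 + e)" by (simp add: tanh_real_altdef e_def)
  then have "1 - tanh \<beta> = 2 * e / (1 + e)" "1 + tanh \<beta> = 2 / (1 + e)"
    using \<open>e > 0\<close> by (simp_all add: field_simps)
  then show ?thesis using \<open>e > 0\<close> unfolding e_def[symmetric] by simp
qed

lemma exp_minus_four_eq_tanh: "exp (- (4 * \<beta>)) = ((1 - tanh \<beta>) / (1 + tanh \<beta>))\<^sup>2" for \<beta> :: real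
proof -
  have "exp (- (4 * \<beta>)) = (exp (- (2 * \<beta>)))\<^sup>2"
    by (simp add: power2_eq_square flip: exp_add)
  then show ?thesis by (simp add: exp_minus_twice_eq_tanh)
qed

lemma tanh_pos_bounds: "0 < tanh \<beta>" "tanh \<beta> < 1" if "0 < \<beta>" for \<beta> :: real
  using that by (auto simp: tanh_real_lt_1)

text \<open>The discriminant under the root is a perfect square in this parameter: up to the factor
\<open>(1 + \<theta> m\<^sup>2)\<^sup>2\<close> it is \<open>(1 + \<theta> m\<^sup>2)\<^sup>2 - 4 \<theta> m\<^sup>2 = (1 - \<theta> m\<^sup>2)\<^sup>2\<close>. The value on the right is
\<open>exp (- 2 * artanh (\<theta> * m))\<close>.\<close>

lemma ising_f_at_magnetisation:
  fixes \<beta> m :: real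
  assumes "0 < \<beta>" "0 \<le> m" "m \<le> 1"
  defines "\<theta> \<equiv> tanh \<beta>"
  shows "ising_f \<beta> ((1 - magnetisation \<theta> m) / 2) = (1 - \<theta> * m) / (1 + \<theta> * m)"
proof -
  have th: "0 < \<theta>" "\<theta> < 1" using tanh_pos_bounds[OF assms(1)] by (auto simp: \<theta>_def)
  note b = cavity_product_less_one[OF th assms(2,3)]
  define D where "D = 1 + \<theta> * m\<^sup>2"
  have D: "D > 0" using denominator_pos[OF th(1)] by (simp add: D_def)
  have x: "magnetisation \<theta> m = m * (1 + \<theta>) / D" by (simp add: magnetisation_def D_def)
  have "1 + (((1 - \<theta>) / (1 + \<theta>))\<^sup>2 - 1) * (magnetisation \<theta> m)\<^sup>2 = ((1 - \<theta> * m\<^sup>2) / D)\<^sup>2"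
  proof -
    have "((1 - \<theta>) / (1 + \<theta>))\<^sup>2 - 1 = - 4 * \<theta> / (1 + \<theta>)\<^sup>2"
    proof -
      have "(1 - \<theta>)\<^sup>2 = (1 + \<theta>)\<^sup>2 - 4 * \<theta>" by (simp add: power2_eq_square algebra_simps)
      then have "((1 - \<theta>) / (1 + \<theta>))\<^sup>2 = ((1 + \<theta>)\<^sup>2 - 4 * \<theta>) / (1 + \<theta>)\<^sup>2"
        by (simp only: power_divide)
      also have "\<dots> = 1 - 4 * \<theta> / (1 + \<theta>)\<^sup>2" using th by (subst diff_divide_distrib) simp
      finally show ?thesis by simp
    qed
    then have "1 + (((1 - \<theta>) / (1 + \<theta>))\<^sup>2 - 1) * (magnetisation \<theta> m)\<^sup>2 = 1 - 4 * \<theta> * m\<^sup>2 / D\<^sup>2"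
      using th D by (simp add: x power_divide power_mult_distrib)
    also have "\<dots> = (D\<^sup>2 - 4 * \<theta> * m\<^sup>2) / D\<^sup>2" using D by (simp add: diff_divide_distrib)
    also have "D\<^sup>2 - 4 * \<theta> * m\<^sup>2 = (1 - \<theta> * m\<^sup>2)\<^sup>2" by (simp add: D_def power2_eq_square algebra_simps)
    finally show ?thesis by (simp add: power_divide)
  qed
  then have root: "sqrt (1 + (((1 - \<theta>) / (1 + \<theta>))\<^sup>2 - 1) * (magnetisation \<theta> m)\<^sup>2) = (1 - \<theta> * m\<^sup>2) / D"
    using D b by simp
  have num: "(1 - \<theta>) / (1 + \<theta>) * magnetisation \<theta> m + (1 - \<theta> * m\<^sup>2) / D = (1 + m) * (1 - \<theta> * m) / D"
  proof -
    have "(1 - \<theta>) / (1 + \<theta>) * magnetisation \<theta> m = m * (1 - \<theta>) / D" using th by (simp add: x)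
    moreover have "m * (1 - \<theta>) / D + (1 - \<theta> * m\<^sup>2) / D = (m * (1 - \<theta>) + (1 - \<theta> * m\<^sup>2)) / D"
      by (simp add: add_divide_distrib)
    moreover have "m * (1 - \<theta>) + (1 - \<theta> * m\<^sup>2) = (1 + m) * (1 - \<theta> * m)"
      by (simp add: power2_eq_square algebra_simps)
    ultimately show ?thesis by simp
  qed
  have den: "2 * (1 - (1 - magnetisation \<theta> m) / 2) = (1 + m) * (1 + \<theta> * m) / D"
  proof -
    have "2 * (1 - (1 - magnetisation \<theta> m) / 2) = 1 + magnetisation \<theta> m" by (simp add: field_simps)
    then show ?thesis using one_plus_magnetisation[OF th(1), of m] by (simp only: D_def)
  qed
  have x': "1 - 2 * ((1 - magnetisation \<theta> m) / 2) = magnetisation \<theta> m" by (simp add: field_simps)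
  have "ising_f \<beta> ((1 - magnetisation \<theta> m) / 2)
      = ((1 + m) * (1 - \<theta> * m) / D) / ((1 + m) * (1 + \<theta> * m) / D)"
    unfolding ising_f_def x' den
    using num root
    by (simp add: exp_minus_twice_eq_tanh exp_minus_four_eq_tanh \<theta>_def)
  then show ?thesis using D assms(2) b by simp
qed

section \<open>Closed form of the integral\<close>

text \<open>The antiderivative of \<open>u dx\<close>, where \<open>x\<close> is the magnetisation and \<open>u = artanh (\<theta> * m)\<close>. The first
summand \<open>x u\<close> comes from integrating by parts, and the logarithms integrate \<open>- x du\<close>.\<close>

definition edge_term :: "real \<Rightarrow> real \<Rightarrow> real" where
  "edge_term \<theta> m = magnetisation \<theta> m * artanh (\<theta> * m) + ln (1 - (\<theta> * m)\<^sup>2) / 2 - ln (1 + \<theta> * m\<^sup>2) / 2"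

lemma edge_term_has_derivative:
  assumes "0 < \<theta>" "\<theta> < 1" "0 \<le> m" "m \<le> 1"
  shows "(edge_term \<theta> has_real_derivative
           artanh (\<theta> * m) * ((1 + \<theta>) * (1 - \<theta> * m\<^sup>2) / (1 + \<theta> * m\<^sup>2)\<^sup>2)) (at m within S)"
proof -
  note b = cavity_product_less_one[OF assms]
  have sq: "(\<theta> * m)\<^sup>2 < 1" using b by (simp add: abs_square_less_1)
  define E where "E = 1 - (\<theta> * m)\<^sup>2"
  define D where "D = 1 + \<theta> * m\<^sup>2"
  have pos: "E > 0" "D > 0" using sq denominator_pos[OF assms(1), of m] by (auto simp: E_def D_def)
  \<comment> \<open>The second factor in the product rule is cancelled by the derivatives of the two logarithms.\<close>
  have cancel: "\<theta> * magnetisation \<theta> m / E - \<theta> * (\<theta> * m) / E - m * \<theta> / D = 0"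
  proof -
    have "magnetisation \<theta> m - \<theta> * m = m * E / D"
      using pos by (simp add: magnetisation_def D_def E_def field_simps power2_eq_square)
    then have eq: "magnetisation \<theta> m = \<theta> * m + m * E / D" by simp
    show ?thesis unfolding eq using pos by (simp add: field_simps)
  qed
  have "\<bar>\<theta> * m\<bar> < 1" using b by simp
  from DERIV_chain2[OF artanh_real_has_field_derivative[OF this] DERIV_cmult_Id]
  have dA: "((\<lambda>m. artanh (\<theta> * m)) has_real_derivative \<theta> / E) (at m within S)"
    by (simp add: E_def)
  have "(edge_term \<theta> has_real_derivative
      (1 + \<theta>) * (1 - \<theta> * m\<^sup>2) / D\<^sup>2 * artanh (\<theta> * m)
      + (\<theta> * magnetisation \<theta> m / E - \<theta> * (\<theta> * m) / E - m * \<theta> / D)) (at m within S)"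
    unfolding edge_term_def using pos
    by (auto intro!: derivative_eq_intros dA magnetisation_has_derivative assms
        simp: E_def[symmetric] D_def[symmetric])
  then show ?thesis unfolding cancel by (simp add: D_def mult.commute)
qed

lemma ising_f_pos:
  assumes "0 < \<beta>" and s: "0 \<le> s" "s \<le> 1/2"
  shows "0 < ising_f \<beta> s"
proof -
  have th: "0 < tanh \<beta>" "tanh \<beta> < 1" using tanh_pos_bounds[OF assms(1)] .
  obtain m where m: "0 \<le> m" "m \<le> 1" "magnetisation (tanh \<beta>) m = 1 - 2 * s"
    using magnetisation_surj[OF th(1), of "1 - 2 * s"] s by fastforce
  then have "ising_f \<beta> s = (1 - tanh \<beta> * m) / (1 + tanh \<beta> * m)"
    using ising_f_at_magnetisation[OF assms(1) m(1,2)] by simp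
  then show ?thesis using cavity_product_less_one[OF th m(1,2)] by simp
qed

lemma continuous_on_ln_ising_f:
  assumes "0 < \<beta>"
  shows "continuous_on {0..1/2} (\<lambda>s. ln (ising_f \<beta> s))"
proof (intro continuous_on_ln)
  show "continuous_on {0..1/2} (ising_f \<beta>)"
    unfolding ising_f_def by (intro continuous_intros) auto
  show "\<forall>s\<in>{0..1/2}. ising_f \<beta> s \<noteq> 0"
    using ising_f_pos[OF assms] by (metis atLeastAtMost_iff less_irrefl)
qed

text \<open>The integration constant, fixed by the empty integral: the upper limit \<open>(1 - x) / 2\<close>, with \<open>x\<close> the magnetisation,
vanishes at \<open>m = 1\<close>.\<close>

definition edge_const :: "real \<Rightarrow> real" where
  "edge_const \<beta> = ln (cosh \<beta>) / 2 - \<beta> / 2"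

lemma edge_term_one: "edge_term (tanh \<beta>) 1 = - edge_const \<beta>" if "0 < \<beta>"
proof -
  have th: "0 < tanh \<beta>" "tanh \<beta> < 1" using tanh_pos_bounds[OF that] .
  have "1 - tanh \<beta> = exp (- \<beta>) / cosh \<beta>"
    by (simp add: tanh_def field_simps cosh_minus_sinh)
  then have "ln (1 - tanh \<beta>) = - \<beta> - ln (cosh \<beta>)" by (simp add: ln_div)
  moreover have "ln (1 - (tanh \<beta>)\<^sup>2) = ln (1 - tanh \<beta>) + ln (1 + tanh \<beta>)"
  proof -
    have "1 - (tanh \<beta>)\<^sup>2 = (1 - tanh \<beta>) * (1 + tanh \<beta>)"
      by (simp add: power2_eq_square algebra_simps)
    moreover have "0 < 1 - tanh \<beta>" "0 < 1 + tanh \<beta>" using th by linarith+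
    ultimately show ?thesis by (simp add: ln_mult_pos)
  qed
  ultimately show ?thesis
    using th by (simp add: edge_term_def edge_const_def artanh_tanh_real field_simps)
qed

text \<open>Both sides have the same derivative in \<open>m\<close> and agree at \<open>m = 1\<close>. The argument is the smaller of
\<open>t\<close> and \<open>1 - t\<close>, so that it is itself the upper limit of the integral.\<close>

lemma ising_F_at_magnetisation:
  fixes \<beta> m :: real
  assumes "0 < \<beta>" "0 \<le> m" "m \<le> 1"
  shows "ising_F \<beta> ((1 - magnetisation (tanh \<beta>) m) / 2) = edge_term (tanh \<beta>) m + edge_const \<beta>"
proof -
  define \<theta> where "\<theta> = tanh \<beta>"
  have th: "0 < \<theta>" "\<theta> < 1" using tanh_pos_bounds[OF assms(1)] by (auto simp: \<theta>_def)
  define P where "P = (\<lambda>s. integral {0..s} (\<lambda>s. ln (ising_f \<beta> s)))"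
  have dP: "(P has_real_derivative ln (ising_f \<beta> s)) (at s within {0..1/2})"
    if "s \<in> {0..1/2}" for s
    unfolding P_def
    by (intro integral_has_real_derivative continuous_on_ln_ising_f assms that)
  have range: "(\<lambda>m. (1 - magnetisation \<theta> m) / 2) ` {0..1} \<subseteq> {0..1/2}"
    using magnetisation_bounds[OF th] by auto
  have flat: "((\<lambda>m. P ((1 - magnetisation \<theta> m) / 2) - edge_term \<theta> m) has_real_derivative 0) (at x within {0..1})"
    if "x \<in> {0..1}" for x
  proof -
    have x: "0 \<le> x" "x \<le> 1" using that by auto
    note b = cavity_product_less_one[OF th x]
    define D' where "D' = (1 + \<theta>) * (1 - \<theta> * x\<^sup>2) / (1 + \<theta> * x\<^sup>2)\<^sup>2"
    have inner: "((\<lambda>m. (1 - magnetisation \<theta> m) / 2) has_real_derivative - D' / 2) (at x within {0..1})"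
      unfolding D'_def by (auto intro!: derivative_eq_intros magnetisation_has_derivative th)
    have val: "ln (ising_f \<beta> ((1 - magnetisation \<theta> x) / 2)) = - 2 * artanh (\<theta> * x)"
      unfolding \<theta>_def ising_f_at_magnetisation[OF assms(1) x]
      using b twice_artanh_real[of "\<theta> * x"] by (simp add: ln_div \<theta>_def)
    have "(P has_real_derivative - 2 * artanh (\<theta> * x))
        (at ((1 - magnetisation \<theta> x) / 2) within (\<lambda>m. (1 - magnetisation \<theta> m) / 2) ` {0..1})"
      using dP[of "(1 - magnetisation \<theta> x) / 2"] magnetisation_bounds[OF th x] range
      by (auto simp: val intro: DERIV_subset)
    from DERIV_image_chain[OF this inner]
    have "((\<lambda>m. P ((1 - magnetisation \<theta> m) / 2)) has_real_derivative - 2 * artanh (\<theta> * x) * (- D' / 2))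
        (at x within {0..1})" by (simp add: o_def)
    from DERIV_diff[OF this edge_term_has_derivative[OF th x, of "{0..1}"]]
    show ?thesis by (simp add: D'_def)
  qed
  have "\<exists>c. \<forall>x\<in>{0..1}. P ((1 - magnetisation \<theta> x) / 2) - edge_term \<theta> x = c"
    using flat by (rule has_field_derivative_zero_constant[OF convex_real_interval(5)])
  then obtain c where
    c: "\<And>x. x \<in> {0..1} \<Longrightarrow> P ((1 - magnetisation \<theta> x) / 2) - edge_term \<theta> x = c"
    by blast
  have "P 0 - edge_term \<theta> 1 = c" using c[of 1] th by simp
  then have "c = edge_const \<beta>" using edge_term_one[OF assms(1)] by (simp add: P_def \<theta>_def)
  moreover have "P ((1 - magnetisation \<theta> m) / 2) - edge_term \<theta> m = c" using c[of m] assms(2,3) by simp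
  ultimately have "P ((1 - magnetisation \<theta> m) / 2) = edge_term \<theta> m + edge_const \<beta>" by linarith
  moreover have "min ((1 - magnetisation \<theta> m) / 2) (1 - (1 - magnetisation \<theta> m) / 2)
      = (1 - magnetisation \<theta> m) / 2"
  proof (rule min_absorb1)
    have "1 - (1 - magnetisation \<theta> m) / 2 = (1 + magnetisation \<theta> m) / 2" by (simp add: field_simps)
    then show "(1 - magnetisation \<theta> m) / 2 \<le> 1 - (1 - magnetisation \<theta> m) / 2"
      using magnetisation_bounds(1)[OF th assms(2,3)] by (simp only:) (simp add: divide_right_mono)
  qed
  ultimately show ?thesis by (simp only: ising_F_def P_def \<theta>_def)
qed

section \<open>Existence of the maximum and dependence on the field\<close>

lemma ising_F_reflect: "ising_F \<beta> (1 - t) = ising_F \<beta> t"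
  by (simp add: ising_F_def min.commute)

lemma continuous_on_ising_F:
  assumes "0 < \<beta>"
  shows "continuous_on {0..1} (ising_F \<beta>)"
proof -
  have "continuous_on {0..1/2} (\<lambda>s. integral {0..s} (\<lambda>s. ln (ising_f \<beta> s)))"
    by (intro indefinite_integral_continuous_1 integrable_continuous_real
        continuous_on_ln_ising_f assms)
  moreover have "continuous_on {0..1} (\<lambda>t::real. min t (1 - t))"
    by (intro continuous_intros)
  moreover have "(\<lambda>t::real. min t (1 - t)) ` {0..1} \<subseteq> {0..1/2}"
    by (auto simp: min_def)
  ultimately show ?thesis unfolding ising_F_def by (rule continuous_on_compose2)
qed

lemma continuous_on_mult_ln: "continuous_on {0..} (\<lambda>x::real. x * ln x)"
proof -
  have "((\<lambda>x::real. x * ln x) \<longlongrightarrow> 0) (at_right 0)" by real_asymp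
  moreover have "at 0 within {0..} = at_right (0::real)" 
    by (rule at_within_Ici_at_right)
  ultimately have "continuous (at x within {0..}) (\<lambda>x::real. x * ln x)" if "x \<ge> 0" for x
    using that
    by (cases "x = 0") (auto simp: continuous_within intro!: tendsto_eq_intros)
  then show ?thesis by (auto simp: continuous_on_eq_continuous_within)
qed

lemma continuous_on_annealed_objective:
  assumes "0 < \<beta>"
  shows "continuous_on {0..1} (annealed_objective d \<beta> B)"
proof -
  have 1: "continuous_on {0..1} (\<lambda>t::real. t * ln t)"
    using continuous_on_mult_ln by (rule continuous_on_subset) auto
  have 2: "continuous_on {0..1} (\<lambda>t::real. (1 - t) * ln (1 - t))"
    by (rule continuous_on_compose2[OF continuous_on_mult_ln, of _ "\<lambda>t. 1 - t"])
      (intro continuous_intros, auto)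
  have "continuous_on {0..1}
      (\<lambda>t. - ((1 - t) * ln (1 - t)) - t * ln t + 2 * B * t + real d * ising_F \<beta> t)"
    by (intro continuous_intros 1 2 continuous_on_ising_F assms)
  moreover have "- ((1 - t) * ln (1 - t)) = (t - 1) * ln (1 - t)" for t :: real
    by (simp add: algebra_simps)
  ultimately show ?thesis unfolding annealed_objective_def by simp
qed

lemma annealed_objective_reflect:
  "annealed_objective d \<beta> B (1 - t) = annealed_objective d \<beta> (- B) t + 2 * B"
  by (simp add: annealed_objective_def ising_F_reflect algebra_simps)

lemma annealed_objective_field_shift:
  "annealed_objective d \<beta> B t = annealed_objective d \<beta> B' t + 2 * (B - B') * t"
  by (simp add: annealed_objective_def algebra_simps)

lemma annealed_pressure_eqI:
  assumes "t \<in> {0..1}"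
    and "\<And>s. s \<in> {0..1} \<Longrightarrow> annealed_objective d \<beta> B s \<le> annealed_objective d \<beta> B t"
  shows "annealed_pressure d \<beta> B = \<beta> * real d / 2 - B + annealed_objective d \<beta> B t"
proof -
  have "(GREATEST y. y \<in> annealed_objective d \<beta> B ` {0..1}) = annealed_objective d \<beta> B t"
    using assms by (intro Greatest_equality) auto
  then show ?thesis by (simp add: annealed_pressure_def)
qed

lemma annealed_maximizer:
  assumes "0 < \<beta>"
  obtains t where "t \<in> {0..1}"
    and "\<And>s. s \<in> {0..1} \<Longrightarrow> annealed_objective d \<beta> B s \<le> annealed_objective d \<beta> B t"
    and "annealed_pressure d \<beta> B = \<beta> * real d / 2 - B + annealed_objective d \<beta> B t"
proof -
  have "\<exists>t\<in>{0..1}. \<forall>s\<in>{0..1}. annealed_objective d \<beta> B s \<le> annealed_objective d \<beta> B t"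
    by (intro continuous_attains_sup continuous_on_annealed_objective assms) auto
  then show thesis using that annealed_pressure_eqI by metis
qed

text \<open>The reflection \<open>t \<mapsto> 1 - t\<close> exchanges plus and minus spins, which turns \<open>B\<close> into \<open>- B\<close>.\<close>

lemma annealed_pressure_neg:
  assumes "0 < \<beta>"
  shows "annealed_pressure d \<beta> (- B) = annealed_pressure d \<beta> B"
proof -
  obtain t where t: "t \<in> {0..1}"
    and max: "\<And>s. s \<in> {0..1} \<Longrightarrow> annealed_objective d \<beta> B s \<le> annealed_objective d \<beta> B t"
    and p: "annealed_pressure d \<beta> B = \<beta> * real d / 2 - B + annealed_objective d \<beta> B t"
    using annealed_maximizer[OF assms] by metis
  have r: "annealed_objective d \<beta> (- B) s = annealed_objective d \<beta> B (1 - s) - 2 * B" for s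
    using annealed_objective_reflect[of d \<beta> B s] by simp
  have "annealed_pressure d \<beta> (- B) = \<beta> * real d / 2 - (- B) + annealed_objective d \<beta> (- B) (1 - t)"
    using t max by (intro annealed_pressure_eqI) (auto simp: r)
  then show ?thesis by (simp add: p r)
qed

text \<open>For every \<open>t\<close> the field enters the pressure as \<open>B (2 t - 1)\<close>, with slope at most one in absolute
value, and a maximum of functions with a common Lipschitz constant inherits it. This gives continuity at zero
field, where the quenched pressure is defined as a limit.\<close>

lemma annealed_pressure_le:
  assumes "0 < \<beta>"
  shows "annealed_pressure d \<beta> B \<le> annealed_pressure d \<beta> B' + \<bar>B - B'\<bar>"
proof -
  obtain t where t: "t \<in> {0..1}"
    and p: "annealed_pressure d \<beta> B = \<beta> * real d / 2 - B + annealed_objective d \<beta> B t"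
    using annealed_maximizer[OF assms] by metis
  obtain t' where max': "annealed_objective d \<beta> B' t \<le> annealed_objective d \<beta> B' t'"
    and p': "annealed_pressure d \<beta> B' = \<beta> * real d / 2 - B' + annealed_objective d \<beta> B' t'"
    using annealed_maximizer[OF assms] t by metis
  have "(B - B') * (2 * t - 1) \<le> \<bar>B - B'\<bar> * 1"
  proof -
    have "\<bar>2 * t - 1\<bar> \<le> 1" using t by auto
    then have "\<bar>(B - B') * (2 * t - 1)\<bar> \<le> \<bar>B - B'\<bar> * 1"
      unfolding abs_mult by (intro mult_left_mono) auto
    then show ?thesis by linarith
  qed
  then show ?thesis
    using annealed_objective_field_shift[of d \<beta> B t B'] p p' max' by (simp add: algebra_simps)
qed

lemma annealed_pressure_tendsto_zero_field:
  assumes "0 < \<beta>"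
  shows "(annealed_pressure d \<beta> \<longlongrightarrow> annealed_pressure d \<beta> 0) (at_right 0)"
proof (rule tendsto_sandwich)
  let ?A = "annealed_pressure d \<beta>"
  show "\<forall>\<^sub>F B in at_right 0. ?A 0 - \<bar>B\<bar> \<le> ?A B"
    using annealed_pressure_le[OF assms, of d 0] by (auto simp: algebra_simps intro!: always_eventually)
  show "\<forall>\<^sub>F B in at_right 0. ?A B \<le> ?A 0 + \<bar>B\<bar>"
    using annealed_pressure_le[OF assms, of d _ 0] by (auto intro!: always_eventually)
qed (auto intro!: tendsto_eq_intros)

section \<open>The cavity fixed point\<close>

definition cavity_gap :: "nat \<Rightarrow> real \<Rightarrow> real \<Rightarrow> real \<Rightarrow> real" where
  "cavity_gap d \<beta> B h = B + (real d - 1) * artanh (tanh \<beta> * tanh h) - h"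

lemma abs_tanh_mult_less_one: "\<bar>tanh \<beta> * tanh h\<bar> < 1" for \<beta> h :: real
proof -
  have "\<bar>tanh \<beta>\<bar> * \<bar>tanh h\<bar> < 1 * 1"
    by (intro mult_strict_mono') (auto simp: abs_less_iff tanh_real_lt_1 tanh_real_gt_neg1
        simp flip: tanh_minus)
  then show ?thesis by (simp add: abs_mult)
qed

lemma cavity_map_has_derivative:
  fixes \<beta> h :: real
  shows "((\<lambda>h. artanh (tanh \<beta> * tanh h)) has_real_derivative
      tanh \<beta> * (1 - (tanh h)\<^sup>2) / (1 - (tanh \<beta> * tanh h)\<^sup>2)) (at h within S)"
proof -
  have "((\<lambda>h. tanh \<beta> * tanh h) has_real_derivative tanh \<beta> * (1 - (tanh h)\<^sup>2)) (at h within S)"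
    by (auto intro!: derivative_eq_intros)
  from DERIV_chain2[OF artanh_real_has_field_derivative[OF abs_tanh_mult_less_one] this]
  show ?thesis by simp
qed

text \<open>The derivative of \<open>artanh (\<theta> tanh h)\<close> is \<open>\<theta> (1 - m\<^sup>2) / (1 - \<theta>\<^sup>2 m\<^sup>2)\<close> with \<open>m = tanh h\<close>, which decreases
in \<open>m\<^sup>2\<close> because \<open>\<theta>\<^sup>2 \<le> 1\<close>.\<close>

lemma cavity_gap_concave:
  assumes "0 < \<beta>" "1 \<le> d"
  shows "concave_on {0..} (cavity_gap d \<beta> B)"
proof -
  define u where "u = (\<lambda>h::real. artanh (tanh \<beta> * tanh h))"
  define u' where "u' = (\<lambda>h::real. tanh \<beta> * (1 - (tanh h)\<^sup>2) / (1 - (tanh \<beta> * tanh h)\<^sup>2))"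
  have th: "0 < tanh \<beta>" "tanh \<beta> < 1" using tanh_pos_bounds[OF assms(1)] .
  have anti: "u' y \<le> u' x" if "0 \<le> x" "x \<le> y" for x y
  proof -
    define a where "a = (tanh x)\<^sup>2"
    define b where "b = (tanh y)\<^sup>2"
    define c where "c = (tanh \<beta>)\<^sup>2"
    have "a \<le> b" unfolding a_def b_def using that by (intro power_mono) auto
    have c: "c \<le> 1" unfolding c_def using th by (intro power_le_one) auto
    have pos: "1 - c * a > 0" "1 - c * b > 0"
      using abs_tanh_mult_less_one[of \<beta> x] abs_tanh_mult_less_one[of \<beta> y]
      by (simp_all add: abs_square_less_1[symmetric] a_def b_def c_def power_mult_distrib)
    have "0 \<le> (1 - c) * (b - a)" using c \<open>a \<le> b\<close> by simp
    then have "(1 - b) * (1 - c * a) \<le> (1 - a) * (1 - c * b)" by (simp add: algebra_simps)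
    then have "(1 - b) / (1 - c * b) \<le> (1 - a) / (1 - c * a)" using pos by (simp add: field_simps)
    then have "tanh \<beta> * ((1 - b) / (1 - c * b)) \<le> tanh \<beta> * ((1 - a) / (1 - c * a))"
      using th by (intro mult_left_mono) auto
    then show ?thesis by (simp add: u'_def a_def b_def c_def power_mult_distrib)
  qed
  have "convex_on {0..} (\<lambda>h. - cavity_gap d \<beta> B h)"
  proof (rule convex_on_realI)
    show "connected {0::real..}" by simp
    show "((\<lambda>h. - cavity_gap d \<beta> B h) has_real_derivative 1 - (real d - 1) * u' h) (at h)"
      for h
      unfolding cavity_gap_def u'_def
      by (auto intro!: derivative_eq_intros cavity_map_has_derivative)
    show "1 - (real d - 1) * u' x \<le> 1 - (real d - 1) * u' y"
      if "x \<in> {0..}" "x \<le> y" for x y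
      using anti[of x y] that assms(2) by (auto intro!: mult_left_mono)
  qed
  then show ?thesis by (simp add: concave_on_def)
qed

text \<open>A concave function that starts at \<open>B > 0\<close> lies above its chord to a zero and, beyond it, below the
continuation of that chord. So there is at most one zero, with a sign change from plus to minus. One exists
because a message is at most \<open>\<beta>\<close>, which makes the gap non-positive at \<open>B + (d - 1) \<beta>\<close>.\<close>

lemma h_star_properties:
  assumes "0 < \<beta>" "1 \<le> d" "0 < B"
  defines "h \<equiv> h_star d \<beta> B"
  shows "0 < h" and "cavity_gap d \<beta> B h = 0"
    and "\<And>x. 0 \<le> x \<Longrightarrow> x < h \<Longrightarrow> 0 < cavity_gap d \<beta> B x"
    and "\<And>x. h < x \<Longrightarrow> cavity_gap d \<beta> B x < 0"
proof -
  let ?g = "cavity_gap d \<beta> B"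
  have th: "0 < tanh \<beta>" "tanh \<beta> < 1" using tanh_pos_bounds[OF assms(1)] .
  have g0: "?g 0 = B" by (simp add: cavity_gap_def)
  have chord: "(1 - r) * B + r * ?g x \<le> ?g (r * x)" if "0 \<le> x" "0 \<le> r" "r \<le> 1" for r x
    using concave_onD[OF cavity_gap_concave[OF assms(1,2), of B], of r 0 x] that g0 by simp
  have below: "0 < ?g x" if "?g k = 0" "0 \<le> x" "x < k" for k x
  proof -
    have "(1 - x / k) * B \<le> ?g x" using chord[of k "x / k"] that by simp
    moreover have "0 < (1 - x / k) * B" using that assms(3) by simp
    ultimately show ?thesis by linarith
  qed
  have above: "?g x < 0" if "?g k = 0" "0 < k" "k < x" for k x
  proof -
    have "(1 - k / x) * B + k / x * ?g x \<le> 0" using chord[of x "k / x"] that by simp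
    moreover have "0 < (1 - k / x) * B" using that assms(3) by simp
    ultimately have "k / x * ?g x < 0" by linarith
    then show ?thesis using that by (simp add: mult_less_0_iff divide_less_0_iff)
  qed
  define M where "M = B + (real d - 1) * \<beta>"
  have M: "0 \<le> M" using assms by (auto simp: M_def intro!: add_nonneg_nonneg)
  have gM: "?g M \<le> 0"
  proof -
    have "tanh \<beta> * tanh M \<le> tanh \<beta>"
      using th tanh_real_lt_1[of M] by (simp add: mult_left_le less_imp_le)
    then have "artanh (tanh \<beta> * tanh M) \<le> artanh (tanh \<beta>)"
      using abs_tanh_mult_less_one[of \<beta> M] th by (intro artanh_real_mono) linarith+
    then have "(real d - 1) * artanh (tanh \<beta> * tanh M) \<le> (real d - 1) * \<beta>"
      using assms(2) by (intro mult_left_mono) (auto simp: artanh_tanh_real)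
    then show ?thesis by (simp add: cavity_gap_def M_def)
  qed
  have "continuous_on {0..M} ?g"
    unfolding cavity_gap_def
    by (intro continuous_intros DERIV_continuous_on) (rule cavity_map_has_derivative)
  then obtain k where k: "0 \<le> k" "?g k = 0"
    using IVT2'[of ?g M 0 0] gM M g0 assms(3) by auto
  have "k > 0" using k g0 assms(3) by (cases "k = 0") auto
  have "h = k" unfolding h_def h_star_def
  proof (rule the_equality)
    show "0 < k \<and> k = B + (real d - 1) * artanh (tanh \<beta> * tanh k)"
      using \<open>k > 0\<close> k by (simp add: cavity_gap_def)
  next
    fix x assume "0 < x \<and> x = B + (real d - 1) * artanh (tanh \<beta> * tanh x)"
    then have "0 < x" "?g x = 0" by (auto simp: cavity_gap_def)
    then show "x = k" using below[OF k(2), of x] above[OF k(2) \<open>k > 0\<close>, of x]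
      by (cases x k rule: linorder_cases) auto
  qed
  then show "0 < h" "?g h = 0" "\<And>x. 0 \<le> x \<Longrightarrow> x < h \<Longrightarrow> 0 < ?g x" "\<And>x. h < x \<Longrightarrow> ?g x < 0"
    using \<open>k > 0\<close> k(2) below[OF k(2)] above[OF k(2) \<open>k > 0\<close>] by auto
qed

section \<open>The maximiser of the annealed objective\<close>

lemma annealed_objective_at_magnetisation:
  fixes \<beta> m :: real
  assumes "0 < \<beta>" "0 \<le> m" "m \<le> 1"
  defines "t \<equiv> (1 + magnetisation (tanh \<beta>) m) / 2"
  shows "annealed_objective d \<beta> B t = (t - 1) * ln (1 - t) - t * ln t + 2 * B * t
           + real d * (edge_term (tanh \<beta>) m + edge_const \<beta>)"
proof -
  have "(1 - magnetisation (tanh \<beta>) m) / 2 = 1 - t" by (simp add: t_def field_simps)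
  then have "ising_F \<beta> t = edge_term (tanh \<beta>) m + edge_const \<beta>"
    using ising_F_at_magnetisation[OF assms(1-3)] ising_F_reflect[of \<beta> t] by metis
  then show ?thesis by (simp add: annealed_objective_def)
qed

text \<open>The log-odds of a plus spin are twice its total field: the cavity field plus one message.\<close>

lemma log_odds_magnetisation:
  assumes "0 < \<theta>" "\<theta> < 1" "0 \<le> m" "m < 1"
  defines "t \<equiv> (1 + magnetisation \<theta> m) / 2"
  shows "0 < t" "t < 1" "ln t - ln (1 - t) = 2 * artanh m + 2 * artanh (\<theta> * m)"
proof -
  note b = cavity_product_less_one[OF assms(1-3) less_imp_le[OF assms(4)]]
  define D where "D = 1 + \<theta> * m\<^sup>2"
  have D: "D > 0" using denominator_pos[OF assms(1)] by (simp add: D_def)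
  have t: "t = (1 + m) * (1 + \<theta> * m) / D / 2"
    using one_plus_magnetisation[OF assms(1), of m] by (simp add: t_def D_def)
  have "1 - t = (1 - magnetisation \<theta> m) / 2" by (simp add: t_def field_simps)
  then have t': "1 - t = (1 - m) * (1 - \<theta> * m) / D / 2"
    using one_minus_magnetisation[OF assms(1), of m] by (simp add: D_def)
  show "0 < t" unfolding t using D b assms(3) by simp
  have "0 < 1 - t" unfolding t' using D b assms(4) by simp
  then show "t < 1" by simp
  show "ln t - ln (1 - t) = 2 * artanh m + 2 * artanh (\<theta> * m)"
    unfolding t' unfolding t using D b assms(3,4)
      twice_artanh_real[of m] twice_artanh_real[of "\<theta> * m"]
    by (simp add: ln_div ln_mult)
qed

lemma binary_entropy_has_derivative:
  fixes t :: real
  assumes "0 < t" "t < 1"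
  shows "((\<lambda>t. (t - 1) * ln (1 - t) - t * ln t) has_real_derivative ln (1 - t) - ln t) (at t)"
proof -
  have "(t - 1) / (1 - t) = -1" using assms by (simp add: field_simps)
  then show ?thesis using assms by (auto intro!: derivative_eq_intros)
qed

text \<open>To the derivative in \<open>t\<close> the entropy contributes minus the log-odds, that is \<open>- 2 (h + u)\<close>, and the
field and the edges contribute
\<open>2 B + 2 d u\<close>. Their sum is twice the cavity gap; the last factor below is twice the derivative
of \<open>t\<close> in \<open>m\<close>.\<close>

lemma annealed_objective_magnetisation_has_derivative:
  fixes \<beta> m :: real
  assumes "0 < \<beta>" "0 < m" "m < 1"
  shows "((\<lambda>m. annealed_objective d \<beta> B ((1 + magnetisation (tanh \<beta>) m) / 2)) has_real_derivative
      cavity_gap d \<beta> B (artanh m)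
       * ((1 + tanh \<beta>) * (1 - tanh \<beta> * m\<^sup>2) / (1 + tanh \<beta> * m\<^sup>2)\<^sup>2)) (at m)"
proof -
  define \<theta> where "\<theta> = tanh \<beta>"
  have th: "0 < \<theta>" "\<theta> < 1" using tanh_pos_bounds[OF assms(1)] by (auto simp: \<theta>_def)
  define \<tau> where "\<tau> = (\<lambda>m. (1 + magnetisation \<theta> m) / 2)"
  define D' where "D' = (1 + \<theta>) * (1 - \<theta> * m\<^sup>2) / (1 + \<theta> * m\<^sup>2)\<^sup>2"
  have odds: "0 < \<tau> m" "\<tau> m < 1" "ln (\<tau> m) - ln (1 - \<tau> m) = 2 * artanh m + 2 * artanh (\<theta> * m)"
    using log_odds_magnetisation[OF th less_imp_le[OF assms(2)] assms(3)] by (simp_all add: \<tau>_def)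
  have d\<tau>: "(\<tau> has_real_derivative D' / 2) (at m)"
    unfolding \<tau>_def D'_def by (auto intro!: derivative_eq_intros magnetisation_has_derivative th)
  have dE: "(edge_term \<theta> has_real_derivative artanh (\<theta> * m) * D') (at m)"
    unfolding D'_def using edge_term_has_derivative[OF th, of m] assms by simp
  have dS: "((\<lambda>m. (\<tau> m - 1) * ln (1 - \<tau> m) - \<tau> m * ln (\<tau> m)) has_real_derivative
      (ln (1 - \<tau> m) - ln (\<tau> m)) * (D' / 2)) (at m)"
    by (rule DERIV_chain2[OF binary_entropy_has_derivative[OF odds(1,2)] d\<tau>])
  have "((\<lambda>m. (\<tau> m - 1) * ln (1 - \<tau> m) - \<tau> m * ln (\<tau> m) + 2 * B * \<tau> m
        + real d * (edge_term \<theta> m + edge_const \<beta>)) has_real_derivative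
      (ln (1 - \<tau> m) - ln (\<tau> m)) * (D' / 2) + 2 * B * (D' / 2) + real d * (artanh (\<theta> * m) * D' + 0)) (at m)"
    by (intro DERIV_add DERIV_cmult dS d\<tau> dE DERIV_const)
  also have "(ln (1 - \<tau> m) - ln (\<tau> m)) * (D' / 2) + 2 * B * (D' / 2) + real d * (artanh (\<theta> * m) * D' + 0)
      = cavity_gap d \<beta> B (artanh m) * D'"
  proof -
    have l: "ln (1 - \<tau> m) - ln (\<tau> m) = - 2 * (artanh m + artanh (\<theta> * m))"
      using odds(3) by simp
    have "tanh (artanh m) = m" using assms by (simp add: tanh_artanh_real)
    then show ?thesis unfolding l by (simp add: cavity_gap_def \<theta>_def algebra_simps)
  qed
  finally have *: "((\<lambda>m. (\<tau> m - 1) * ln (1 - \<tau> m) - \<tau> m * ln (\<tau> m) + 2 * B * \<tau> m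
        + real d * (edge_term \<theta> m + edge_const \<beta>)) has_real_derivative
      cavity_gap d \<beta> B (artanh m) * D') (at m)" .
  have "((\<lambda>m. annealed_objective d \<beta> B (\<tau> m)) has_real_derivative
      cavity_gap d \<beta> B (artanh m) * D') (at m)"
    by (rule has_field_derivative_transform_within_open[OF *, of "{0<..<1}"])
      (use assms in \<open>auto simp: annealed_objective_at_magnetisation \<tau>_def \<theta>_def\<close>)
  then show ?thesis by (simp add: \<tau>_def \<theta>_def D'_def)
qed

text \<open>On \<open>t \<ge> 1/2\<close> the sign of the cavity gap makes the objective increase up to \<open>tanh h_star\<close> and decrease
afterwards. For \<open>t < 1/2\<close> the reflected point gains \<open>2 B (1 - 2 t) > 0\<close>.\<close>

lemma annealed_objective_le_at_h_star:
  assumes "0 < \<beta>" "1 \<le> d" "0 < B" "s \<in> {0..1}"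
  shows "annealed_objective d \<beta> B s
    \<le> annealed_objective d \<beta> B ((1 + magnetisation (tanh \<beta>) (tanh (h_star d \<beta> B))) / 2)"
proof -
  define \<theta> where "\<theta> = tanh \<beta>"
  have th: "0 < \<theta>" "\<theta> < 1" using tanh_pos_bounds[OF assms(1)] by (auto simp: \<theta>_def)
  define h where "h = h_star d \<beta> B"
  note h = h_star_properties[OF assms(1-3), folded h_def]
  define k where "k = tanh h"
  have k: "0 < k" "k < 1" using h(1) by (auto simp: k_def tanh_real_lt_1)
  define g where "g = (\<lambda>m. annealed_objective d \<beta> B ((1 + magnetisation \<theta> m) / 2))"
  define g' where "g' = (\<lambda>m. cavity_gap d \<beta> B (artanh m)
       * ((1 + \<theta>) * (1 - \<theta> * m\<^sup>2) / (1 + \<theta> * m\<^sup>2)\<^sup>2))"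
  have dg: "(g has_real_derivative g' m) (at m)" if "0 < m" "m < 1" for m
    using annealed_objective_magnetisation_has_derivative[OF assms(1) that, of d B]
    by (simp add: g_def g'_def \<theta>_def)
  have cont: "continuous_on {0..1} g"
    unfolding g_def
  proof (rule continuous_on_compose2[OF continuous_on_annealed_objective[OF assms(1)]])
    have "continuous_on {0..1} (magnetisation \<theta>)"
      by (rule DERIV_continuous_on) (rule magnetisation_has_derivative[OF th(1)])
    then show "continuous_on {0..1} (\<lambda>m. (1 + magnetisation \<theta> m) / 2)" by (intro continuous_intros) auto
  qed (use magnetisation_bounds[OF th] in \<open>auto simp: field_simps intro: add_nonneg_nonneg\<close>)
  have weight: "0 \<le> (1 + \<theta>) * (1 - \<theta> * m\<^sup>2) / (1 + \<theta> * m\<^sup>2)\<^sup>2" if "0 < m" "m < 1" for m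
    using th cavity_product_less_one(3)[OF th, of m] that by simp
  have inc: "0 \<le> g' m" if m: "0 < m" "m < k" for m
  proof -
    have "m < 1" using m k by simp
    then have tm: "tanh (artanh m) = m" using m by (simp add: tanh_artanh_real)
    have "0 < artanh m" using m tm by (metis tanh_real_pos_iff)
    moreover have "artanh m < h" using m tm unfolding k_def by (metis tanh_real_less_iff)
    ultimately show ?thesis
      unfolding g'_def using h(3)[of "artanh m"] weight[OF m(1) \<open>m < 1\<close>] by (intro mult_nonneg_nonneg) auto
  qed
  have dec: "g' m \<le> 0" if m: "k < m" "m < 1" for m
  proof -
    have "0 < m" using m k by simp
    then have "tanh (artanh m) = m" using m by (simp add: tanh_artanh_real)
    then have "h < artanh m" using m unfolding k_def by (metis tanh_real_less_iff)
    then show ?thesis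
      unfolding g'_def using h(4)[of "artanh m"] weight[OF \<open>0 < m\<close> m(2)] by (intro mult_nonpos_nonneg) auto
  qed
  have max: "g m \<le> g k" if "0 \<le> m" "m \<le> 1" for m
  proof (cases "m \<le> k")
    case True
    show ?thesis
    proof (rule DERIV_nonneg_imp_increasing_open[OF True])
      show "\<exists>y. (g has_real_derivative y) (at x) \<and> 0 \<le> y" if "m < x" "x < k" for x
        using dg[of x] inc[of x] that \<open>0 \<le> m\<close> k by (intro exI[of _ "g' x"]) auto
      show "continuous_on {m..k} g"
        using cont by (rule continuous_on_subset) (use that k in auto)
    qed
  next
    case False
    then have "k \<le> m" by simp
    then show ?thesis
    proof (rule DERIV_nonpos_imp_decreasing_open)
      show "\<exists>y. (g has_real_derivative y) (at x) \<and> y \<le> 0" if "k < x" "x < m" for x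
        using dg[of x] dec[of x] that \<open>m \<le> 1\<close> k by (intro exI[of _ "g' x"]) auto
      show "continuous_on {k..m} g"
        using cont by (rule continuous_on_subset) (use that k in auto)
    qed
  qed
  have upper: "annealed_objective d \<beta> B r \<le> g k" if r: "1/2 \<le> r" "r \<le> 1" for r
  proof -
    obtain m where m: "0 \<le> m" "m \<le> 1" "magnetisation \<theta> m = 2 * r - 1"
      using magnetisation_surj[OF th(1), of "2 * r - 1"] r by fastforce
    then show ?thesis using max[OF m(1,2)] by (simp add: g_def)
  qed
  have "annealed_objective d \<beta> B s \<le> g k"
  proof (cases "1/2 \<le> s")
    case True
    then show ?thesis using upper[of s] assms(4) by simp
  next
    case False
    have "annealed_objective d \<beta> B (1 - s) = annealed_objective d \<beta> B s + 2 * B * (1 - 2 * s)"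
      using annealed_objective_reflect[of d \<beta> B s] annealed_objective_field_shift[of d \<beta> "- B" s B]
      by (simp add: algebra_simps)
    moreover have "0 \<le> 2 * B * (1 - 2 * s)" using False assms(3) by simp
    moreover have "annealed_objective d \<beta> B (1 - s) \<le> g k"
      using upper[of "1 - s"] False assms(4) by simp
    ultimately show ?thesis by linarith
  qed
  then show ?thesis by (simp add: g_def k_def h_def \<theta>_def)
qed

text \<open>Let \<open>X\<close> and \<open>Y\<close> be the plus and minus weights in the quenched formula and \<open>p = t\<close>. The fixed-point
equation says \<open>X / Y = p / (1 - p)\<close>, so \<open>ln p\<close> and \<open>ln (1 - p)\<close> are \<open>ln X\<close> and \<open>ln Y\<close> minus
\<open>ln (X + Y)\<close>. Inserted into the entropy, this leaves \<open>ln (X + Y)\<close> and terms that cancel against the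
field term and the edge term.\<close>

lemma annealed_objective_at_fixed_point:
  assumes "0 < \<beta>" "0 \<le> h" "cavity_gap d \<beta> B h = 0"
  defines "v \<equiv> tanh \<beta> * tanh h"
  shows "\<beta> * real d / 2 - B + annealed_objective d \<beta> B ((1 + magnetisation (tanh \<beta>) (tanh h)) / 2)
    = real d / 2 * ln (cosh \<beta>) - real d / 2 * ln (1 + tanh \<beta> * (tanh h)\<^sup>2)
      + ln (exp B * (1 + v) ^ d + exp (- B) * (1 - v) ^ d)"
proof -
  have th: "0 < tanh \<beta>" "tanh \<beta> < 1" using tanh_pos_bounds[OF assms(1)] .
  have m: "0 \<le> tanh h" "tanh h < 1" using assms(2) by (auto simp: tanh_real_lt_1)
  have v: "0 \<le> v" "v < 1" using cavity_product_less_one[OF th, of "tanh h"] m by (auto simp: v_def)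
  define p where "p = (1 + magnetisation (tanh \<beta>) (tanh h)) / 2"
  define X where "X = exp B * (1 + v) ^ d"
  define Y where "Y = exp (- B) * (1 - v) ^ d"
  have pos: "X > 0" "Y > 0" using v by (auto simp: X_def Y_def)
  note odds = log_odds_magnetisation[OF th m, folded p_def v_def]
  have lnX: "ln X = B + real d * ln (1 + v)" and lnY: "ln Y = - B + real d * ln (1 - v)"
    using v by (simp_all add: X_def Y_def ln_mult ln_realpow)
  have u: "2 * artanh v = ln (1 + v) - ln (1 - v)" using v by (simp add: twice_artanh_real)
  have stat: "h = B + (real d - 1) * artanh v"
    using assms(3) by (simp add: cavity_gap_def v_def)
  have "ln p - ln (1 - p) = 2 * h + 2 * artanh v"
    using odds(3) by (simp add: artanh_tanh_real)
  also have "\<dots> = 2 * B + real d * (2 * artanh v)" by (simp add: stat algebra_simps)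
  also have "\<dots> = ln X - ln Y" unfolding u lnX lnY by (simp add: algebra_simps)
  finally have "ln (p * Y) = ln (X * (1 - p))"
    using odds(1,2) pos by (simp add: ln_mult)
  then have "p * Y = X * (1 - p)"
    using odds(1,2) pos by (subst (asm) ln_inj_iff) auto
  then have pX: "X = p * (X + Y)" and pY: "Y = (1 - p) * (X + Y)" by (simp_all add: algebra_simps)
  have "ln X = ln p + ln (X + Y)" using odds(1) pos by (subst pX) (simp add: ln_mult)
  moreover have "ln Y = ln (1 - p) + ln (X + Y)" using odds(2) pos by (subst pY) (simp add: ln_mult)
  ultimately have lp: "ln p = ln X - ln (X + Y)" and lq: "ln (1 - p) = ln Y - ln (X + Y)" by auto
  have mg: "magnetisation (tanh \<beta>) (tanh h) = 2 * p - 1" by (simp add: p_def field_simps)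
  have sq: "ln (1 - v\<^sup>2) = ln (1 + v) + ln (1 - v)"
  proof -
    have "1 - v\<^sup>2 = (1 + v) * (1 - v)" by (simp add: power2_eq_square algebra_simps)
    then show ?thesis using v by (simp add: ln_mult_pos)
  qed
  have av: "artanh v = (ln (1 + v) - ln (1 - v)) / 2" using u by simp
  note objective = annealed_objective_at_magnetisation[OF assms(1) m(1) less_imp_le[OF m(2)], of d B,
      folded p_def]
  show ?thesis
    unfolding p_def[symmetric] objective
    unfolding X_def[symmetric] Y_def[symmetric] edge_term_def edge_const_def
      v_def[symmetric] lp lq lnX lnY mg sq av
    by (simp add: field_simps)
qed

section \<open>Equality of the pressures\<close>

lemma annealed_eq_quenched_pos:
  assumes "0 < \<beta>" "1 \<le> d" "0 < B"
  shows "annealed_pressure d \<beta> B = quenched_pressure_pos d \<beta> B"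
proof -
  define h where "h = h_star d \<beta> B"
  note h = h_star_properties[OF assms, folded h_def]
  have th: "0 < tanh \<beta>" "tanh \<beta> < 1" using tanh_pos_bounds[OF assms(1)] .
  have m: "0 \<le> tanh h" "tanh h \<le> 1" using h(1) by (auto simp: tanh_real_lt_1 less_imp_le)
  have "annealed_pressure d \<beta> B = \<beta> * real d / 2 - B
      + annealed_objective d \<beta> B ((1 + magnetisation (tanh \<beta>) (tanh h)) / 2)"
    using magnetisation_bounds[OF th m] annealed_objective_le_at_h_star[OF assms]
    by (intro annealed_pressure_eqI) (auto simp: h_def)
  also have "\<dots> = quenched_pressure_pos d \<beta> B"
    using annealed_objective_at_fixed_point[OF assms(1) less_imp_le[OF h(1)] h(2)]
    by (simp add: quenched_pressure_pos_def h_def)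
  finally show ?thesis .
qed

lemma annealed_eq_quenched:
  assumes "0 < \<beta>" "1 \<le> d"
  shows "annealed_pressure d \<beta> B = quenched_pressure d \<beta> B"
proof (cases B "0 :: real" rule: linorder_cases)
  case less
  then show ?thesis
    using annealed_eq_quenched_pos[OF assms, of "- B"] annealed_pressure_neg[OF assms(1), of d B]
    by (simp add: quenched_pressure_def)
next
  case equal
  have "\<forall>\<^sub>F B in at_right 0. annealed_pressure d \<beta> B = quenched_pressure_pos d \<beta> B"
    using annealed_eq_quenched_pos[OF assms] by (auto simp: eventually_at_filter)
  then have "(quenched_pressure_pos d \<beta> \<longlongrightarrow> annealed_pressure d \<beta> 0) (at_right 0)"
    using annealed_pressure_tendsto_zero_field[OF assms(1)] by (rule Lim_transform_eventually[rotated])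
  then show ?thesis using equal by (simp add: quenched_pressure_def tendsto_Lim)
next
  case greater
  then show ?thesis
    using annealed_eq_quenched_pos[OF assms] by (simp add: quenched_pressure_def)
qed

section \<open>The one-dimensional case\<close>

text \<open>For \<open>d = 2\<close> the fixed-point equation reads \<open>B = h - artanh (\<theta> m)\<close>, so \<open>tanh B\<close>, and with it \<open>cosh B\<close>,
\<open>sinh B\<close> and the root, are rational in \<open>\<theta>\<close> and \<open>m\<close> up to the common denominator
\<open>n = sqrt ((1 - m\<^sup>2) (1 - \<theta>\<^sup>2 m\<^sup>2))\<close>. Both formulas then exponentiate to the same number \<open>W\<close>, the larger
eigenvalue of the transfer matrix of the Ising chain.\<close>

lemma quenched_pressure_pos_two:
  assumes "0 < \<beta>" "0 < B"
  shows "quenched_pressure_pos 2 \<beta> B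
    = \<beta> + ln (cosh B + sqrt ((sinh B)\<^sup>2 + exp (- (4 * \<beta>))))"
proof -
  define \<theta> where "\<theta> = tanh \<beta>"
  define h where "h = h_star 2 \<beta> B"
  define m where "m = tanh h"
  have th: "0 < \<theta>" "\<theta> < 1" using tanh_pos_bounds[OF assms(1)] by (auto simp: \<theta>_def)
  have h: "0 < h" "h = B + artanh (\<theta> * m)"
    using h_star_properties(1,2)[of \<beta> 2 B] assms
    by (auto simp: h_def cavity_gap_def \<theta>_def m_def)
  have m: "0 < m" "m < 1" using h(1) by (auto simp: m_def tanh_real_lt_1)
  note b = cavity_product_less_one[OF th, of m]
  have v: "0 \<le> \<theta> * m" "\<theta> * m < 1" "\<theta> * m\<^sup>2 < 1" using b m by auto
  define D where "D = 1 + \<theta> * m\<^sup>2"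
  have D: "D > 0" using denominator_pos[OF th(1)] by (simp add: D_def)
  define n where "n = sqrt ((1 - m\<^sup>2) * (1 - (\<theta> * m)\<^sup>2))"
  have "m\<^sup>2 < 1" "(\<theta> * m)\<^sup>2 < 1" using m v by (simp_all add: abs_square_less_1)
  then have n: "n > 0" "n\<^sup>2 = (1 - m\<^sup>2) * (1 - (\<theta> * m)\<^sup>2)" by (simp_all add: n_def)
  have tB: "tanh B = m * (1 - \<theta>) / (1 - \<theta> * m\<^sup>2)"
  proof -
    have "B = h + (- artanh (\<theta> * m))" using h(2) by simp
    then have "tanh B = tanh (h + (- artanh (\<theta> * m)))" by simp
    also have "\<dots> = (m - \<theta> * m) / (1 - m * (\<theta> * m))"
      using v by (subst tanh_add) (auto simp: m_def tanh_artanh_real)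
    finally show ?thesis by (simp add: power2_eq_square algebra_simps)
  qed
  have cB: "cosh B = (1 - \<theta> * m\<^sup>2) / n"
  proof -
    have "(cosh B)\<^sup>2 * (1 - (tanh B)\<^sup>2) = 1"
    proof -
      have "(cosh B)\<^sup>2 * (tanh B)\<^sup>2 = (sinh B)\<^sup>2"
        by (simp add: tanh_def power_divide)
      then show ?thesis by (simp add: right_diff_distrib cosh_square_eq)
    qed
    moreover have "1 - (tanh B)\<^sup>2 = n\<^sup>2 / (1 - \<theta> * m\<^sup>2)\<^sup>2"
    proof -
      have "1 - (tanh B)\<^sup>2
          = ((1 - \<theta> * m\<^sup>2)\<^sup>2 - (m * (1 - \<theta>))\<^sup>2) / (1 - \<theta> * m\<^sup>2)\<^sup>2"
        using v(3) unfolding tB power_divide by (subst diff_divide_distrib) simp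
      also have "(1 - \<theta> * m\<^sup>2)\<^sup>2 - (m * (1 - \<theta>))\<^sup>2 = n\<^sup>2"
        unfolding n(2) by (simp add: power2_eq_square algebra_simps)
      finally show ?thesis .
    qed
    ultimately have "(cosh B)\<^sup>2 * (n\<^sup>2 / (1 - \<theta> * m\<^sup>2)\<^sup>2) = 1" by metis
    then have "(cosh B)\<^sup>2 = ((1 - \<theta> * m\<^sup>2) / n)\<^sup>2"
      using n(1) v(3) unfolding power_divide by (simp add: nonzero_eq_divide_eq nonzero_divide_eq_eq)
    then show ?thesis using n v(3) by (simp add: power2_eq_iff_nonneg)
  qed
  have sB: "sinh B = m * (1 - \<theta>) / n"
  proof -
    have "sinh B = tanh B * cosh B" by (simp add: tanh_def)
    then show ?thesis using v(3) by (simp add: tB cB)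
  qed
  have root: "sqrt ((sinh B)\<^sup>2 + exp (- (4 * \<beta>))) = (1 - \<theta>) * D / (n * (1 + \<theta>))"
  proof -
    have "(sinh B)\<^sup>2 + exp (- (4 * \<beta>)) = (m * (1 - \<theta>) / n)\<^sup>2 + ((1 - \<theta>) / (1 + \<theta>))\<^sup>2"
      by (simp add: sB exp_minus_four_eq_tanh \<theta>_def)
    also have "\<dots> = (1 - \<theta>)\<^sup>2 * (m\<^sup>2 * (1 + \<theta>)\<^sup>2 + n\<^sup>2) / (n * (1 + \<theta>))\<^sup>2"
    proof -
      have "(m * a / n)\<^sup>2 + (a / b)\<^sup>2 = a\<^sup>2 * (m\<^sup>2 * b\<^sup>2 + n\<^sup>2) / (n * b)\<^sup>2" if "b \<noteq> 0" for a b
        using that n(1) by (simp add: field_simps power2_eq_square)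
      then show ?thesis using th by simp
    qed
    also have "m\<^sup>2 * (1 + \<theta>)\<^sup>2 + n\<^sup>2 = D\<^sup>2"
      unfolding n(2) D_def by (simp add: power2_eq_square algebra_simps)
    finally have "(sinh B)\<^sup>2 + exp (- (4 * \<beta>)) = ((1 - \<theta>) * D / (n * (1 + \<theta>)))\<^sup>2"
      by (simp add: power_mult_distrib power_divide)
    then show ?thesis using n(1) th D by simp
  qed
  define W where "W = cosh \<beta> * (2 * (1 - (\<theta> * m)\<^sup>2) / n)"
  have rhs: "exp \<beta> * (cosh B + sqrt ((sinh B)\<^sup>2 + exp (- (4 * \<beta>)))) = W"
  proof -
    have e: "exp \<beta> = cosh \<beta> * (1 + \<theta>)"
      by (simp add: \<theta>_def tanh_def distrib_left cosh_plus_sinh)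
    have "cosh B + sqrt ((sinh B)\<^sup>2 + exp (- (4 * \<beta>)))
        = ((1 - \<theta> * m\<^sup>2) * (1 + \<theta>) + (1 - \<theta>) * D) / (n * (1 + \<theta>))"
    proof -
      have "x / n + y / (n * b) = (x * b + y) / (n * b)" if "b \<noteq> 0" for x y b
        using that n(1) by (simp add: field_simps)
      then show ?thesis unfolding root cB using th by simp
    qed
    also have "(1 - \<theta> * m\<^sup>2) * (1 + \<theta>) + (1 - \<theta>) * D = 2 * (1 - (\<theta> * m)\<^sup>2)"
      by (simp add: D_def power2_eq_square algebra_simps)
    finally show ?thesis using th by (simp add: e W_def)
  qed
  have lhs: "cosh \<beta> / D * (exp B * (1 + \<theta> * m)\<^sup>2 + exp (- B) * (1 - \<theta> * m)\<^sup>2) = W"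
  proof -
    have eB: "exp B = cosh B + sinh B" "exp (- B) = cosh B - sinh B"
      by (simp_all add: cosh_plus_sinh cosh_minus_sinh)
    have "exp B * (1 + \<theta> * m)\<^sup>2 + exp (- B) * (1 - \<theta> * m)\<^sup>2
        = 2 * cosh B * (1 + (\<theta> * m)\<^sup>2) + 4 * (\<theta> * m) * sinh B"
      unfolding eB by (simp add: power2_eq_square algebra_simps)
    also have "\<dots> = (2 * (1 - \<theta> * m\<^sup>2) * (1 + (\<theta> * m)\<^sup>2) + 4 * (\<theta> * m) * (m * (1 - \<theta>))) / n"
      unfolding cB sB by (simp add: add_divide_distrib)
    also have "2 * (1 - \<theta> * m\<^sup>2) * (1 + (\<theta> * m)\<^sup>2) + 4 * (\<theta> * m) * (m * (1 - \<theta>))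
        = D * (2 * (1 - (\<theta> * m)\<^sup>2))"
      by (simp add: D_def power2_eq_square algebra_simps)
    finally show ?thesis using D by (simp add: W_def)
  qed
  have "quenched_pressure_pos 2 \<beta> B
      = ln (cosh \<beta>) - ln D + ln (exp B * (1 + \<theta> * m)\<^sup>2 + exp (- B) * (1 - \<theta> * m)\<^sup>2)"
    by (simp add: quenched_pressure_pos_def D_def \<theta>_def m_def h_def)
  also have "\<dots> = ln (cosh \<beta> / D * (exp B * (1 + \<theta> * m)\<^sup>2 + exp (- B) * (1 - \<theta> * m)\<^sup>2))"
  proof -
    have "0 < exp B * (1 + \<theta> * m)\<^sup>2 + exp (- B) * (1 - \<theta> * m)\<^sup>2"
      using v by (intro add_pos_nonneg) auto
    then show ?thesis using D by (simp add: ln_mult ln_div)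
  qed
  also have "\<dots> = ln (exp \<beta> * (cosh B + sqrt ((sinh B)\<^sup>2 + exp (- (4 * \<beta>)))))"
    by (simp only: lhs rhs)
  also have "\<dots> = \<beta> + ln (cosh B + sqrt ((sinh B)\<^sup>2 + exp (- (4 * \<beta>))))"
  proof -
    have "0 < cosh B + sqrt ((sinh B)\<^sup>2 + exp (- (4 * \<beta>)))"
      by (intro add_pos_nonneg) auto
    then show ?thesis by (simp add: ln_mult_pos)
  qed
  finally show ?thesis .
qed

lemma annealed_pressure_two:
  assumes "0 < \<beta>"
  shows "annealed_pressure 2 \<beta> B
    = \<beta> + ln (cosh B + sqrt ((sinh B)\<^sup>2 + exp (- (4 * \<beta>))))"
proof -
  define R where "R = (\<lambda>B. \<beta> + ln (cosh B + sqrt ((sinh B)\<^sup>2 + exp (- (4 * \<beta>)))))"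
  have pos: "annealed_pressure 2 \<beta> B = R B" if "0 < B" for B
    using annealed_eq_quenched_pos[of \<beta> 2 B] quenched_pressure_pos_two[OF assms that] assms that
    by (simp add: R_def)
  have "annealed_pressure 2 \<beta> B = R B"
  proof (cases B "0 :: real" rule: linorder_cases)
    case less
    then show ?thesis
      using pos[of "- B"] annealed_pressure_neg[OF assms, of 2 B] by (simp add: R_def)
  next
    case equal
    have "isCont R 0" unfolding R_def
      by (intro continuous_intros) (auto simp: add_nonneg_eq_0_iff)
    then have "(R \<longlongrightarrow> R 0) (at_right 0)"
      by (auto simp: isCont_def intro: tendsto_within_subset)
    moreover have "\<forall>\<^sub>F B in at_right 0. annealed_pressure 2 \<beta> B = R B"
      using pos by (auto simp: eventually_at_filter)
    then have "(R \<longlongrightarrow> annealed_pressure 2 \<beta> 0) (at_right 0)"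
      using annealed_pressure_tendsto_zero_field[OF assms] by (rule Lim_transform_eventually[rotated])
    ultimately show ?thesis
      using equal tendsto_unique[OF trivial_limit_at_right_real] by blast
  next
    case greater
    then show ?thesis by (rule pos)
  qed
  then show ?thesis by (simp add: R_def)
qed

theorem proposition3p2:
  fixes d :: nat and \<beta> B :: real
  assumes "d \<ge> 2" and "\<beta> > 0"
  shows "annealed_pressure d \<beta> B = quenched_pressure d \<beta> B \<and>
    (d = 2 \<longrightarrow>
      annealed_pressure d \<beta> B =
        \<beta> + ln (cosh B + sqrt ((sinh B)\<^sup>2 + exp (- 4 * \<beta>))))"
  using annealed_eq_quenched[of \<beta> d B] annealed_pressure_two[of \<beta> B] assms by simp

end
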